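(* Under either the Log-Euclidean or the Log-Cholesky geometry, the pooling map is itself nonlinear. Without any non-linear activation after the Pooling layer, the repeated block "BiMap $\to$ Pooling $\to$ BiMap $\to$ Pooling" will not collapse to a single "BiMap $\to$ Pooling" block.
   Context: $\mathcal{S}^n_+$ denotes the set of real symmetric positive definite $n\times n$ matrices. Let $\phi$ be either the principal matrix logarithm $\log$ (Log-Euclidean geometry), a bijection from $\mathcal{S}^n_+$ onto the real symmetric $n\times n$ matrices with inverse the matrix exponential, or the log-Cholesky coordinate map $\Phi:\mathcal{S}^n_+\to\mathbb{R}^{n(n+1)/2}$ (Log-Cholesky geometry), the bijection sending $\mathbf{X}$ to the vector of strictly lower triangular entries of its Cholesky factor together with the logarithms of the diagonal entries of its Cholesky factor; the Cholesky factor is the unique lower triangular matrix $\mathbf{L}$ with positive diagonal such that $\mathbf{X}=\mathbf{L}\mathbf{L}^{\top}$. A (multi-head) BiMap layer with $H$ heads, with input dimension $n$ and output dimension $k<n$, sends $\mathbf{X}\in\mathcal{S}^n_+$ to the matrices $\mathbf{W}^h\mathbf{X}(\mathbf{W}^h)^{\top}\in\mathcal{S}^k_+$, $h=1,\ldots,H$, where each $\mathbf{W}^h\in\mathbb{R}^{k\times n}$ has orthonormal rows ($\mathbf{W}^h(\mathbf{W}^h)^{\top}=\mathbf{I}_k$). The Pooling layer replaces these $H$ matrices by their Fréchet mean in the chosen geometry, so that a "BiMap $\to$ Pooling" block is the map $$F(\mathbf{X};\{\mathbf{W}^h\}_{h=1}^H)=\phi^{-1}\Big(\frac{1}{H}\sum_{h=1}^H\phi\big(\mathbf{W}^h\mathbf{X}(\mathbf{W}^h)^{\top}\big)\Big).$$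 The repeated block is the composition of two such maps, with successively smaller dimensions and with no activation between them; to collapse means to be equal to a single map of this form. *)

theory Defs
  imports "HOL-Analysis.Analysis"
begin

text \<open>
  Matrix dimensions are the cardinalities of index types.  The Cholesky factor depends on the
  order of the indices, so square matrices are indexed by a \<^class>\<open>wellorder\<close> where it is involved;
  on a finite type this is the same as a linear order.
\<close>

definition sym_mats :: "(real^'n^'n) set" where
  "sym_mats = {A. transpose A = A}"

definition spd :: "(real^'n^'n) set" where
  "spd = {A \<in> sym_mats. \<forall>v. v \<noteq> 0 \<longrightarrow> v \<bullet> (A *v v) > 0}"

text \<open>
  Multiplication and powers from the type class hierarchy act componentwise on \<^typ>\<open>real^'n^'n\<close>, so
  the library's \<^const>\<open>exp\<close> is not the matrix exponential.
\<close>

definition mat_exp :: "real^'n^'n \<Rightarrow> real^'n^'n" where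
  "mat_exp A = (\<Sum>i. (1 / fact i) *\<^sub>R (((**) A) ^^ i) (mat 1))"

text \<open>
  The principal logarithm of a positive definite matrix is its only symmetric logarithm.
\<close>

definition mat_log :: "real^'n^'n \<Rightarrow> real^'n^'n" where
  "mat_log X = (THE S. S \<in> sym_mats \<and> mat_exp S = X)"

definition cholesky ::
    "real^('n::{finite,wellorder})^('n::{finite,wellorder}) \<Rightarrow> real^('n::{finite,wellorder})^('n::{finite,wellorder})" where
  "cholesky X = (THE L. (\<forall>i j. i < j \<longrightarrow> L $ i $ j = 0) \<and> (\<forall>i. L $ i $ i > 0)
                        \<and> X = L ** transpose L)"

text \<open>
  The positions on or below the diagonal; \<open>real^'n lower_index\<close> is the space
  of dimension $n(n+1)/2$ in which the log-Cholesky coordinates live.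
\<close>

typedef (overloaded) ('n::wellorder) lower_index = "{(i, j). j \<le> (i::'n)}"
  by auto

instance lower_index :: ("{finite,wellorder}") finite
proof
  have "inj (Rep_lower_index :: 'a lower_index \<Rightarrow> _)"
    by (simp add: inj_def Rep_lower_index_inject)
  then show "finite (UNIV :: 'a lower_index set)"
    by (rule finite_imageD[rotated]) simp
qed

definition log_cholesky ::
    "real^('n::{finite,wellorder})^('n::{finite,wellorder}) \<Rightarrow> real^('n lower_index)" where
  "log_cholesky X = (\<chi> p. case Rep_lower_index p of (i, j) \<Rightarrow>
      if i = j then ln (cholesky X $ i $ i) else cholesky X $ i $ j)"

definition mean_via :: "(real^'n^'n \<Rightarrow> 'v::real_vector) \<Rightarrow> 'h set \<Rightarrow> ('h \<Rightarrow> real^'n^'n) \<Rightarrow> real^'n^'n"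
  where "mean_via \<phi> I X = inv_into spd \<phi> ((1 / real (card I)) *\<^sub>R (\<Sum>h\<in>I. \<phi> (X h)))"

text \<open>
  The two coordinate maps have codomains of different type, but the resulting means do not, which
  is why the choice of the geometry is made here.
\<close>

datatype geometry = Log_Euclidean | Log_Cholesky

definition pooling ::
    "geometry \<Rightarrow> 'h set \<Rightarrow> ('h \<Rightarrow> real^('n::{finite,wellorder})^('n::{finite,wellorder})) \<Rightarrow>
      real^('n::{finite,wellorder})^('n::{finite,wellorder})" where
  "pooling g I X = (case g of
      Log_Euclidean \<Rightarrow> mean_via mat_log I X
    | Log_Cholesky \<Rightarrow> mean_via log_cholesky I X)"

definition orthonormal_rows :: "real^'n^'k \<Rightarrow> bool" where
  "orthonormal_rows W \<longleftrightarrow> W ** transpose W = mat 1"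

definition bimap :: "real^'n^'k \<Rightarrow> real^'n^'n \<Rightarrow> real^'k^'k" where
  "bimap W X = W ** X ** transpose W"

text \<open>Only the weights with index below the number \<open>H\<close> of heads matter.\<close>

definition bimap_pooling ::
    "geometry \<Rightarrow> nat \<Rightarrow> (nat \<Rightarrow> real^'n^('k::{finite,wellorder})) \<Rightarrow> real^'n^'n \<Rightarrow>
      real^('k::{finite,wellorder})^('k::{finite,wellorder})" where
  "bimap_pooling g H W X = pooling g {..<H} (\<lambda>h. bimap (W h) X)"

end

theory Submission
  imports Defs
begin

text \<open>
  On the matrices \<open>diag_at i t\<close>, diagonal with entry \<open>t\<close> at \<open>i\<close> and \<open>1\<close> elsewhere, both geometries
  pool by taking the geometric mean of the entries, which is not linear.

  In both geometries the logarithm of the determinant is a linear function of the coordinates, so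
  the \<open>H\<close>-th power of the determinant of the output of a single block is the product of the
  determinants of its \<open>H\<close> BiMap images, a polynomial in the entries of the input.  For the repeated
  block, let the first layer select coordinates so that only one of its \<open>H1\<close> heads sees the entry
  \<open>s ^ H1\<close> of the input; its pooling produces \<open>diag_at p s\<close>.  Let the second layer average the
  coordinate \<open>p\<close> with another one; its output has determinant \<open>(1 + s) / 2\<close>.  A collapse would make
  \<open>((1 + s) / 2) ^ H\<close> a polynomial in \<open>s ^ H1\<close> for \<open>s > 0\<close>, which is impossible for \<open>H1 \<ge> 2\<close>.
\<close>

section \<open>The spectral theorem\<close>

text \<open>Subtracting the maximum times the identity gives \<open>g\<close>, whose quadratic form
  is at most 0 on \<open>V\<close> and equals 0 at \<open>x\<close>. A step from \<open>x\<close>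
  towards \<open>g x\<close> would make it positive to first order unless
  \<open>g x = 0\<close>.\<close>

lemma self_adjoint_eigenvector_at_max:
  fixes f :: "'a::euclidean_space \<Rightarrow> 'a"
  assumes f: "linear f" and sa: "\<And>x y. f x \<bullet> y = x \<bullet> f y"
    and V: "subspace V" and inv: "f ` V \<subseteq> V"
    and x: "x \<in> V" "norm x = 1"
    and max: "\<And>y. y \<in> V \<Longrightarrow> norm y = 1 \<Longrightarrow> y \<bullet> f y \<le> x \<bullet> f x"
  shows "f x = (x \<bullet> f x) *\<^sub>R x"
proof -
  define g where "g y = f y - (x \<bullet> f x) *\<^sub>R y" for y
  have xx: "x \<bullet> x = 1"
    using x by (simp add: dot_square_norm)
  have neg: "y \<bullet> g y \<le> 0" if "y \<in> V" for y
  proof (cases "y = 0")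
    case False
    define u where "u = (1 / norm y) *\<^sub>R y"
    have "u \<in> V" "norm u = 1" and yu: "y = norm y *\<^sub>R u"
      using that V False by (auto simp: u_def subspace_mul)
    then have "norm y ^ 2 * (u \<bullet> f u) \<le> norm y ^ 2 * (x \<bullet> f x)"
      by (intro mult_left_mono max) auto
    moreover have "y \<bullet> f y = norm y ^ 2 * (u \<bullet> f u)"
      by (subst (1 2) yu) (simp add: linear_cmul[OF f] power2_eq_square)
    ultimately show ?thesis
      by (simp add: g_def inner_diff_right dot_square_norm mult.commute)
  qed (simp add: g_def)
  define y where "y = g x"
  have yV: "y \<in> V"
    using inv V x by (auto simp: y_def g_def intro!: subspace_diff subspace_mul)
  have gx: "x \<bullet> g x = 0"
    by (simp add: g_def inner_diff_right xx)
  have quad: "2 * s * (y \<bullet> y) + s ^ 2 * (y \<bullet> g y) \<le> 0" for s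
  proof -
    have "(x + s *\<^sub>R y) \<bullet> g (x + s *\<^sub>R y) = x \<bullet> g x + 2 * s * (y \<bullet> g x) + s ^ 2 * (y \<bullet> g y)"
      using sa[of x y]
      by (simp add: g_def linear_add[OF f] linear_cmul[OF f] inner_diff_right inner_add_left
          inner_add_right power2_eq_square inner_commute algebra_simps)
    moreover have "x + s *\<^sub>R y \<in> V"
      using V x yV by (simp add: subspace_add subspace_mul)
    ultimately show ?thesis
      using neg[of "x + s *\<^sub>R y"] gx by (simp add: y_def)
  qed
  have "y \<bullet> y \<le> 0"
  proof (rule ccontr)
    assume "\<not> y \<bullet> y \<le> 0"
    then have pos: "y \<bullet> y > 0" by linarith
    define c where "c = \<bar>y \<bullet> g y\<bar> + 1"
    \<comment> \<open>This size makes the bound \<open>s * (s * c)\<close> on the quadratic loss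
      half of the linear gain \<open>2 * s * (y \<bullet> y)\<close>; the summand 1 keeps
      \<open>c\<close> positive.\<close>
    define s where "s = (y \<bullet> y) / c"
    have c: "c > 0" "- c \<le> y \<bullet> g y" by (auto simp: c_def)
    have s: "s > 0" using pos c by (simp add: s_def)
    have "s ^ 2 * - c \<le> s ^ 2 * (y \<bullet> g y)"
      by (rule mult_left_mono) (use c in auto)
    with quad[of s] have "2 * s * (y \<bullet> y) \<le> s * (s * c)"
      by (simp add: power2_eq_square algebra_simps)
    with s have "2 * (y \<bullet> y) \<le> s * c" by (simp add: mult.left_commute)
    with c pos show False by (simp add: s_def)
  qed
  then have "y = 0"
    by (metis inner_gt_zero_iff not_less)
  then show ?thesis by (simp add: y_def g_def)
qed

text \<open>Induction on the dimension: a maximiser of the form on the unit sphere of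
  \<open>V\<close> is an eigenvector, and self-adjointness makes its orthogonal complement
  \<open>U\<close> in \<open>V\<close> invariant again.\<close>

lemma self_adjoint_orthonormal_eigenbasis:
  fixes f :: "'a::euclidean_space \<Rightarrow> 'a"
  assumes f: "linear f" and sa: "\<And>x y. f x \<bullet> y = x \<bullet> f y"
    and "subspace V" and "f ` V \<subseteq> V"
  shows "\<exists>B. pairwise orthogonal B \<and> (\<forall>b\<in>B. norm b = 1 \<and> f b = (b \<bullet> f b) *\<^sub>R b) \<and> span B = V"
  using assms(3,4)
proof (induction "dim V" arbitrary: V rule: less_induct)
  case less
  show ?case
  proof (cases "V = {0}")
    case True
    then show ?thesis by (intro exI[of _ "{}"]) auto
  next
    case False
    let ?S = "V \<inter> sphere 0 1"
    obtain v where v: "v \<in> V" "v \<noteq> 0"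
      using False subspace_0[OF less.prems(1)] by auto
    then have "(1 / norm v) *\<^sub>R v \<in> ?S"
      using less.prems(1) by (auto simp: subspace_mul)
    moreover have "compact ?S"
      using less.prems(1) by (auto intro: closed_Int_compact closed_subspace)
    moreover have "continuous_on ?S (\<lambda>x. x \<bullet> f x)"
      using f by (auto intro: continuous_intros linear_continuous_on simp: linear_conv_bounded_linear)
    ultimately obtain x where x: "x \<in> ?S" and max: "\<And>y. y \<in> ?S \<Longrightarrow> y \<bullet> f y \<le> x \<bullet> f x"
      using continuous_attains_sup[of ?S "\<lambda>x. x \<bullet> f x"] by blast
    have fx: "f x = (x \<bullet> f x) *\<^sub>R x"
      by (rule self_adjoint_eigenvector_at_max[OF f sa less.prems]) (use x max in auto)
    define U where "U = V \<inter> {y. orthogonal x y}"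
    have U: "subspace U"
      unfolding U_def using less.prems(1) subspace_orthogonal_to_vector by (rule subspace_inter)
    have invU: "f ` U \<subseteq> U"
    proof -
      have "x \<bullet> f y = 0" if "x \<bullet> y = 0" for y
        using sa[of x y] that by (subst (asm) fx) simp
      then show ?thesis
        using less.prems(2) by (auto simp: U_def orthogonal_def)
    qed
    have "x \<notin> U" using x by (auto simp: U_def orthogonal_def)
    then have "U \<subset> V" using x by (auto simp: U_def)
    then have "dim U < dim V"
      by (metis U less.prems(1) dim_psubset span_eq_iff)
    from less.hyps[OF this U invU] obtain B where
      B: "pairwise orthogonal B" "\<forall>b\<in>B. norm b = 1 \<and> f b = (b \<bullet> f b) *\<^sub>R b" "span B = U" by auto
    have "B \<subseteq> U" using B(3) span_superset by blast
    then have "pairwise orthogonal (insert x B)"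
      using B(1) by (auto simp: pairwise_insert U_def orthogonal_commute)
    moreover have "\<forall>b\<in>insert x B. norm b = 1 \<and> f b = (b \<bullet> f b) *\<^sub>R b"
      using B(2) x fx by auto
    moreover have "span (insert x B) = V"
    proof
      show "span (insert x B) \<subseteq> V"
        using x \<open>B \<subseteq> U\<close> less.prems(1) by (intro span_minimal) (auto simp: U_def)
      show "V \<subseteq> span (insert x B)"
      proof
        fix y assume y: "y \<in> V"
        have "y - (x \<bullet> y) *\<^sub>R x \<in> U"
          using y x less.prems(1)
          by (auto simp: U_def orthogonal_def inner_diff_right dot_square_norm subspace_diff subspace_mul)
        then show "y \<in> span (insert x B)"
          using B(3) by (auto simp: span_insert)
      qed
    qed
    ultimately show ?thesis by blast
  qed
qed

section \<open>Diagonal matrices and the spectral decomposition\<close>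

definition diag_mat :: "('n \<Rightarrow> real) \<Rightarrow> real^'n^'n" where
  "diag_mat d = (\<chi> i j. if i = j then d i else 0)"

lemma diag_mat_nth: "diag_mat d $ i $ j = (if i = j then d i else 0)"
  by (simp add: diag_mat_def)

lemma diag_mat_mult_nth: "(diag_mat d ** M) $ i $ j = d i * M $ i $ j"
  by (simp add: diag_mat_nth matrix_matrix_mult_def if_distrib[of "\<lambda>x. x * _"] sum.delta cong: if_cong)

lemma mult_diag_mat_nth: "(M ** diag_mat d) $ i $ j = M $ i $ j * d j"
  by (simp add: diag_mat_nth matrix_matrix_mult_def if_distrib[of "\<lambda>x. _ * x"] sum.delta cong: if_cong)

lemma diag_mat_vec_nth: "(diag_mat d *v x) $ i = d i * x $ i"
  by (simp add: diag_mat_nth matrix_vector_mult_def if_distrib[of "\<lambda>x. x * _"] sum.delta cong: if_cong)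

lemma transpose_diag_mat [simp]: "transpose (diag_mat d) = diag_mat d"
  by (simp add: vec_eq_iff transpose_def diag_mat_nth)

lemma diag_mat_mult_diag_mat: "diag_mat d ** diag_mat e = diag_mat (\<lambda>i. d i * e i)"
  by (simp add: vec_eq_iff diag_mat_mult_nth diag_mat_nth)

lemma diag_mat_1 [simp]: "diag_mat (\<lambda>_. 1) = mat 1"
  by (simp add: vec_eq_iff diag_mat_nth mat_def)

lemma det_diag_mat: "det (diag_mat d) = (\<Prod>i\<in>UNIV. d i)"
  by (simp add: det_diagonal diag_mat_nth)

lemma diag_mat_spd:
  assumes "\<And>i. d i > 0"
  shows "diag_mat d \<in> spd"
proof -
  have "v \<bullet> (diag_mat d *v v) > 0" if v: "v \<noteq> 0" for v
  proof -
    obtain i where "v $ i \<noteq> 0" using v by (metis vec_eq_iff zero_index)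
    then have "(\<Sum>i\<in>UNIV. d i * (v $ i)\<^sup>2) > 0"
      using assms by (intro sum_pos2[of _ i]) (auto simp: less_imp_le)
    then show ?thesis
      by (simp add: inner_vec_def diag_mat_vec_nth power2_eq_square algebra_simps)
  qed
  then show ?thesis by (simp add: spd_def sym_mats_def)
qed

theorem symmetric_spectral_decomposition:
  fixes A :: "real^'n^'n"
  assumes "A \<in> sym_mats"
  obtains Q d where "orthogonal_matrix Q" and "A = Q ** diag_mat d ** transpose Q"
proof -
  let ?f = "(*v) A"
  have sa: "?f x \<bullet> y = x \<bullet> ?f y" for x y
    using assms by (metis (mono_tags, lifting) dot_lmul_matrix mem_Collect_eq sym_mats_def transpose_matrix_vector)
  obtain B where B: "pairwise orthogonal B" "\<And>b. b \<in> B \<Longrightarrow> norm b = 1"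
      "\<And>b. b \<in> B \<Longrightarrow> A *v b = (b \<bullet> (A *v b)) *\<^sub>R b" "span B = UNIV"
    using self_adjoint_orthonormal_eigenbasis[of ?f UNIV] sa by auto
  have "0 \<notin> B" using B(2) by fastforce
  then have indep: "independent B"
    using B(1) pairwise_orthogonal_independent by blast
  \<comment> \<open>An independent spanning set has as many elements as there are indices, so the
    eigenbasis can be indexed by \<open>'n\<close> and written as the columns of
    \<open>Q\<close>.\<close>
  then have "card B = CARD('n)" "finite B"
    using B(4) dim_eq_card[of B UNIV] finiteI_independent by (auto simp: dim_UNIV)
  then obtain b where b: "bij_betw b (UNIV :: 'n set) B"
    by (metis finite_same_card_bij finite)
  have bB: "b i \<in> B" for i using b by (auto simp: bij_betw_def)
  have ortho: "b i \<bullet> b j = (if i = j then 1 else 0)" for i j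
  proof (cases "i = j")
    case False
    then have "b i \<noteq> b j" using b by (auto simp: bij_betw_def inj_def)
    with B(1) bB False show ?thesis by (auto simp: pairwise_def orthogonal_def)
  qed (use B(2)[OF bB] in \<open>simp add: dot_square_norm\<close>)
  define Q :: "real^'n^'n" where "Q = (\<chi> i j. b j $ i)"
  define d where "d i = b i \<bullet> (A *v b i)" for i
  have Q: "orthogonal_matrix Q"
    by (simp add: orthogonal_matrix vec_eq_iff matrix_matrix_mult_def transpose_def Q_def mat_def
        ortho[unfolded inner_vec_def, simplified])
  have "A ** Q = Q ** diag_mat d"
  proof -
    have "(A ** Q) $ i $ j = (A *v b j) $ i" for i j
      by (simp add: matrix_matrix_mult_def matrix_vector_mult_def Q_def)
    then show ?thesis
      using B(3)[OF bB] by (simp add: vec_eq_iff mult_diag_mat_nth) (simp add: Q_def d_def)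
  qed
  then have "A ** (Q ** transpose Q) = Q ** diag_mat d ** transpose Q"
    by (simp add: matrix_mul_assoc)
  then have "A = Q ** diag_mat d ** transpose Q"
    using Q by (simp add: orthogonal_matrix_def)
  with Q show thesis using that by blast
qed

section \<open>Congruences of symmetric and positive definite matrices\<close>

lemma inner_matrix_congruence:
  fixes A :: "real^'n^'n" and M :: "real^'n^'m"
  shows "v \<bullet> ((M ** A ** transpose M) *v v) = (transpose M *v v) \<bullet> (A *v (transpose M *v v))"
  by (metis dot_lmul_matrix matrix_vector_mul_assoc transpose_matrix_vector)

lemma congruence_sym_mats:
  "A \<in> sym_mats \<Longrightarrow> M ** A ** transpose M \<in> sym_mats"
  by (simp add: sym_mats_def matrix_transpose_mul matrix_mul_assoc)

lemma diag_mat_sym_mats [simp]: "diag_mat d \<in> sym_mats"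
  by (simp add: sym_mats_def)

text \<open>The right inverse makes \<open>transpose M\<close> injective, so nonzero test vectors
  stay nonzero. It covers BiMap layers and orthogonal changes of basis, both with
  \<open>R = transpose M\<close>.\<close>

lemma congruence_spd:
  fixes A :: "real^'n^'n" and M :: "real^'n^'m"
  assumes "A \<in> spd" and "M ** R = mat 1"
  shows "M ** A ** transpose M \<in> spd"
proof -
  have "transpose R *v (transpose M *v v) = v" for v
    using assms(2) by (metis matrix_transpose_mul matrix_vector_mul_assoc matrix_vector_mul_lid transpose_mat)
  then have "transpose M *v v \<noteq> 0" if "v \<noteq> 0" for v
    using that by (metis matrix_vector_mult_0_right)
  with assms(1) show ?thesis
    by (simp add: spd_def congruence_sym_mats inner_matrix_congruence)
qed

lemma bimap_spd: "orthonormal_rows W \<Longrightarrow> X \<in> spd \<Longrightarrow> bimap W X \<in> spd"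
  unfolding bimap_def orthonormal_rows_def by (rule congruence_spd)

lemma orthogonal_congruence_mult:
  fixes Q :: "real^'n^'n"
  assumes "orthogonal_matrix Q"
  shows "(Q ** A ** transpose Q) ** (Q ** B ** transpose Q) = Q ** (A ** B) ** transpose Q"
proof -
  have "(Q ** A ** transpose Q) ** (Q ** B ** transpose Q)
      = Q ** A ** (transpose Q ** Q) ** B ** transpose Q"
    by (simp add: matrix_mul_assoc)
  then show ?thesis
    using assms unfolding orthogonal_matrix_def by (simp only: matrix_mul_rid matrix_mul_assoc)
qed

section \<open>The matrix exponential and logarithm\<close>

text \<open>Orthogonal congruence commutes with powers and is linear and continuous in the diagonal,
  so the series is summed entry by entry on the eigenvalues.\<close>

lemma mat_exp_spectral:
  fixes Q :: "real^'n^'n"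
  assumes Q: "orthogonal_matrix Q"
  shows "mat_exp (Q ** diag_mat d ** transpose Q) = Q ** diag_mat (\<lambda>i. exp (d i)) ** transpose Q"
proof -
  \<comment> \<open>As a map from the vector of eigenvalues, the congruence is bounded linear and
    carries convergent series over.\<close>
  define \<Psi> :: "real^'n \<Rightarrow> real^'n^'n" where "\<Psi> v = Q ** diag_mat (($) v) ** transpose Q" for v
  have nth: "($) (vec_lambda f) = f" for f :: "'n \<Rightarrow> real"
    by (simp add: fun_eq_iff)
  have "linear \<Psi>"
    by (rule linearI)
       (simp_all add: \<Psi>_def vec_eq_iff matrix_matrix_mult_def diag_mat_nth sum.distrib[symmetric]
         sum_distrib_left sum_distrib_right algebra_simps if_distrib[of "\<lambda>x. _ * x"] cong: if_cong)
  then have bl: "bounded_linear \<Psi>"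
    by (simp add: linear_conv_bounded_linear)
  let ?A = "Q ** diag_mat d ** transpose Q"
  have pow: "(((**) ?A) ^^ m) (mat 1) = \<Psi> (\<chi> i. d i ^ m)" for m
  proof (induction m)
    case 0
    then show ?case using Q by (simp add: \<Psi>_def nth orthogonal_matrix_def)
  next
    case (Suc m)
    then show ?case by (simp add: \<Psi>_def nth orthogonal_congruence_mult[OF Q] diag_mat_mult_diag_mat)
  qed
  have "(\<lambda>m. \<chi> i. (1 / fact m) * d i ^ m) sums (\<chi> i. exp (d i))"
    unfolding sums_def
  proof (rule vec_tendstoI)
    fix i
    have "(\<lambda>m. d i ^ m /\<^sub>R fact m) sums exp (d i)" by (rule exp_converges)
    then show "(\<lambda>n. (\<Sum>m<n. \<chi> i. (1 / fact m) * d i ^ m) $ i) \<longlonglongrightarrow> (\<chi> i. exp (d i)) $ i"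
      by (simp add: sums_def field_simps)
  qed
  from bounded_linear.sums[OF bl this]
  have "(\<lambda>m. \<Psi> (\<chi> i. (1 / fact m) * d i ^ m)) sums \<Psi> (\<chi> i. exp (d i))" .
  moreover have "\<Psi> (\<chi> i. (1 / fact m) * d i ^ m) = (1 / fact m) *\<^sub>R \<Psi> (\<chi> i. d i ^ m)" for m
    using linear_cmul[OF \<open>linear \<Psi>\<close>, of "1 / fact m" "\<chi> i. d i ^ m"] by (simp add: scaleR_vec_def)
  ultimately have "(\<lambda>m. (1 / fact m) *\<^sub>R \<Psi> (\<chi> i. d i ^ m)) sums \<Psi> (\<chi> i. exp (d i))"
    by simp
  then have "mat_exp ?A = \<Psi> (\<chi> i. exp (d i))"
    by (simp add: mat_exp_def pow sums_iff)
  then show ?thesis by (simp add: \<Psi>_def nth)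
qed

lemma mat_exp_diag_mat: "mat_exp (diag_mat d) = diag_mat (\<lambda>i. exp (d i))"
  using mat_exp_spectral[OF orthogonal_matrix_id, of d] by simp

lemma mat_exp_inj_on_sym_mats: "inj_on mat_exp sym_mats"
proof (rule inj_onI)
  fix S T :: "real^'n^'n"
  assume S: "S \<in> sym_mats" and T: "T \<in> sym_mats" and eq: "mat_exp S = mat_exp T"
  obtain Q d where Q: "orthogonal_matrix Q" and Sd: "S = Q ** diag_mat d ** transpose Q"
    using symmetric_spectral_decomposition[OF S] .
  obtain P e where P: "orthogonal_matrix P" and Te: "T = P ** diag_mat e ** transpose P"
    using symmetric_spectral_decomposition[OF T] .
  have QQ: "transpose Q ** Q = mat 1" "Q ** transpose Q = mat 1"
    and PP: "transpose P ** P = mat 1" "P ** transpose P = mat 1"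
    using P Q by (auto simp: orthogonal_matrix_def)
  \<comment> \<open>The change of basis \<open>M\<close> intertwines the exponentials of the eigenvalues, hence only
    links equal eigenvalues, and so intertwines the eigenvalues themselves.\<close>
  define M where "M = transpose P ** Q"
  have "transpose P ** (Q ** diag_mat (\<lambda>i. exp (d i)) ** transpose Q) ** Q
      = transpose P ** (P ** diag_mat (\<lambda>i. exp (e i)) ** transpose P) ** Q"
    using eq by (simp add: Sd Te mat_exp_spectral P Q)
  moreover have "transpose P ** (Q ** D ** transpose Q) ** Q = M ** D" for D
    by (metis M_def QQ(1) matrix_mul_assoc matrix_mul_rid)
  moreover have "transpose P ** (P ** D ** transpose P) ** Q = D ** M" for D
    by (metis M_def PP(1) matrix_mul_assoc matrix_mul_lid)
  ultimately have "M ** diag_mat (\<lambda>i. exp (d i)) = diag_mat (\<lambda>i. exp (e i)) ** M"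
    by simp
  then have "M $ i $ j * exp (d j) = exp (e i) * M $ i $ j" for i j
    by (metis diag_mat_mult_nth mult_diag_mat_nth)
  then have "M $ i $ j = 0 \<or> d j = e i" for i j
    by (metis exp_inj_iff mult.commute mult_left_cancel)
  then have "M $ i $ j * d j = e i * M $ i $ j" for i j
    by (metis mult.commute mult_zero_left)
  then have "M ** diag_mat d = diag_mat e ** M"
    by (simp add: vec_eq_iff diag_mat_mult_nth mult_diag_mat_nth)
  then have "P ** (M ** diag_mat d) ** transpose Q = P ** (diag_mat e ** M) ** transpose Q"
    by simp
  moreover have "P ** (M ** diag_mat d) ** transpose Q = S"
    unfolding Sd M_def by (metis PP(2) matrix_mul_assoc matrix_mul_lid)
  moreover have "P ** (diag_mat e ** M) ** transpose Q = T"
    unfolding Te M_def by (metis QQ(2) matrix_mul_assoc matrix_mul_rid)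
  ultimately show "S = T" by simp
qed

lemma mat_exp_spd: "S \<in> sym_mats \<Longrightarrow> mat_exp S \<in> spd"
  by (metis congruence_spd diag_mat_spd exp_gt_zero mat_exp_spectral orthogonal_matrix_def
      symmetric_spectral_decomposition)

lemma det_orthogonal_congruence:
  fixes Q :: "real^'n^'n"
  assumes "orthogonal_matrix Q"
  shows "det (Q ** A ** transpose Q) = det A"
proof -
  have "det Q * det (transpose Q) = 1"
    using assms by (metis det_I det_mul orthogonal_matrix_def)
  then show ?thesis by (simp add: det_mul)
qed

lemma trace_orthogonal_congruence:
  fixes Q :: "real^'n^'n"
  assumes "orthogonal_matrix Q"
  shows "trace (Q ** A ** transpose Q) = trace A"
  using assms
  by (metis matrix_mul_assoc matrix_mul_lid orthogonal_matrix_def trace_mul_sym)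

lemma det_mat_exp:
  assumes "S \<in> sym_mats"
  shows "det (mat_exp S) = exp (trace S)"
proof -
  obtain Q d where Q: "orthogonal_matrix Q" and S: "S = Q ** diag_mat d ** transpose Q"
    using symmetric_spectral_decomposition[OF assms] .
  show ?thesis
    by (simp add: S mat_exp_spectral[OF Q] det_orthogonal_congruence[OF Q]
        trace_orthogonal_congruence[OF Q] det_diag_mat) (simp add: trace_def diag_mat_nth exp_sum)
qed

text \<open>The diagonal factor is itself a congruence of \<open>X\<close>, hence positive definite;
  testing it on the axis vectors gives positive eigenvalues.\<close>

lemma spd_spectral_decomposition:
  fixes X :: "real^'n^'n"
  assumes "X \<in> spd"
  obtains Q d where "orthogonal_matrix Q" and "\<And>i. d i > 0"
    and "X = Q ** diag_mat d ** transpose Q"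
proof -
  obtain Q d where Q: "orthogonal_matrix Q" and X: "X = Q ** diag_mat d ** transpose Q"
    using assms symmetric_spectral_decomposition[of X] by (auto simp: spd_def)
  have "transpose Q ** X ** transpose (transpose Q) = diag_mat d"
    unfolding X using Q
    by (metis matrix_mul_assoc matrix_mul_lid matrix_mul_rid orthogonal_matrix_def transpose_transpose)
  then have D: "diag_mat d \<in> spd"
    using congruence_spd[OF assms, of "transpose Q" Q] Q by (simp add: orthogonal_matrix_def)
  have "d i > 0" for i
  proof -
    have "axis i 1 \<bullet> (diag_mat d *v axis i 1) > 0"
      using D by (simp add: spd_def axis_eq_0_iff)
    then show ?thesis
      by (simp add: inner_axis' diag_mat_vec_nth)
  qed
  with Q X show thesis using that by blast
qed

lemma spd_exists_sym_log: "X \<in> spd \<Longrightarrow> \<exists>S \<in> sym_mats. mat_exp S = X"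
proof -
  assume "X \<in> spd"
  then obtain Q d where Q: "orthogonal_matrix Q" and d: "\<And>i. d i > 0"
    and X: "X = Q ** diag_mat d ** transpose Q"
    by (rule spd_spectral_decomposition) blast
  have "mat_exp (Q ** diag_mat (\<lambda>i. ln (d i)) ** transpose Q) = X"
    using d by (simp add: mat_exp_spectral[OF Q] X)
  then show ?thesis
    using congruence_sym_mats[OF diag_mat_sym_mats] by blast
qed

lemma mat_log_mat_exp: "S \<in> sym_mats \<Longrightarrow> mat_log (mat_exp S) = S"
  unfolding mat_log_def using mat_exp_inj_on_sym_mats by (intro the_equality) (auto dest: inj_onD)

lemma mat_log_sym_mats: "X \<in> spd \<Longrightarrow> mat_log X \<in> sym_mats"
  using spd_exists_sym_log mat_log_mat_exp by metis

lemma mat_exp_mat_log: "X \<in> spd \<Longrightarrow> mat_exp (mat_log X) = X"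
  using spd_exists_sym_log mat_log_mat_exp by metis

text \<open>The trace is the linear functional of the Log-Euclidean coordinates that yields the
  determinant of a pooled matrix.\<close>

lemma ln_det_eq_trace_mat_log: "X \<in> spd \<Longrightarrow> ln (det X) = trace (mat_log X)"
  by (metis det_mat_exp ln_exp mat_exp_mat_log mat_log_sym_mats)

lemma det_spd_pos: "X \<in> spd \<Longrightarrow> det X > 0"
  by (metis det_mat_exp exp_gt_zero mat_exp_mat_log mat_log_sym_mats)

lemma mat_log_inj_on_spd: "inj_on mat_log spd"
  by (metis inj_onI mat_exp_mat_log)

lemma mat_log_diag_mat:
  assumes "\<And>i. d i > 0"
  shows "mat_log (diag_mat d) = diag_mat (\<lambda>i. ln (d i))"
  using assms mat_log_mat_exp[of "diag_mat (\<lambda>i. ln (d i))"] by (simp add: mat_exp_diag_mat)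

section \<open>The Cholesky decomposition\<close>

definition pos_lower_triangular :: "real^('n::{finite,wellorder})^('n::{finite,wellorder}) \<Rightarrow> bool" where
  "pos_lower_triangular L \<longleftrightarrow> (\<forall>i j. i < j \<longrightarrow> L $ i $ j = 0) \<and> (\<forall>i. L $ i $ i > 0)"

text \<open>The factor \<open>B\<close> is a square root of the eigenvalues applied after
  \<open>transpose Q\<close>. Its left inverse is kept as a witness that the columns of
  \<open>B\<close> are independent.\<close>

lemma spd_eq_transpose_mult:
  fixes X :: "real^'n^'n"
  assumes "X \<in> spd"
  obtains B R :: "real^'n^'n" where "X = transpose B ** B" and "R ** B = mat 1"
proof -
  obtain Q d where Q: "orthogonal_matrix Q" and d: "\<And>i. d i > 0"
    and X: "X = Q ** diag_mat d ** transpose Q"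
    using assms by (rule spd_spectral_decomposition) blast
  define B where "B = diag_mat (\<lambda>i. sqrt (d i)) ** transpose Q"
  define R where "R = Q ** diag_mat (\<lambda>i. 1 / sqrt (d i))"
  have "transpose B ** B = Q ** (diag_mat (\<lambda>i. sqrt (d i)) ** diag_mat (\<lambda>i. sqrt (d i))) ** transpose Q"
    by (simp add: B_def matrix_transpose_mul matrix_mul_assoc)
  also have "\<dots> = X"
    using d by (simp add: X diag_mat_mult_diag_mat less_imp_le)
  finally have 1: "X = transpose B ** B" ..
  have "R ** B = Q ** (diag_mat (\<lambda>i. 1 / sqrt (d i)) ** diag_mat (\<lambda>i. sqrt (d i))) ** transpose Q"
    by (simp add: B_def R_def matrix_mul_assoc)
  also have "\<dots> = mat 1"
    using Q d[THEN less_imp_neq] by (simp add: diag_mat_mult_diag_mat orthogonal_matrix_def)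
  finally show thesis using that 1 by blast
qed

text \<open>QR decomposition of \<open>B\<close>: Gram-Schmidt on its columns yields an orthogonal
  \<open>U\<close> with \<open>U ** B\<close> upper triangular, and the Cholesky factor is the
  transpose of that product.\<close>

lemma cholesky_exists:
  fixes X :: "real^('n::{finite,wellorder})^('n::{finite,wellorder})"
  assumes "X \<in> spd"
  shows "\<exists>L. pos_lower_triangular L \<and> X = L ** transpose L"
proof -
  obtain B R :: "real^('n::{finite,wellorder})^('n::{finite,wellorder})" where X: "X = transpose B ** B" and RB: "R ** B = mat 1"
    using spd_eq_transpose_mult[OF assms] .
  define b where "b j = column j B" for j
  have Rb: "R *v b j = axis j 1" for j
    using RB by (metis b_def matrix_vector_mul_assoc matrix_vector_mul_lid matrix_vector_mult_basis)
  \<comment> \<open>Gram--Schmidt: \<open>q i\<close> is the part of \<open>b i\<close> orthogonal to all earlier \<open>b j\<close>.\<close>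
  have "\<exists>q. \<forall>i. b i - q i \<in> span (b ` {..<i}) \<and> (\<forall>w \<in> span (b ` {..<i}). orthogonal (q i) w)"
  proof (intro choice allI)
    fix i
    obtain y z where "y \<in> span (b ` {..<i})" "\<And>w. w \<in> span (b ` {..<i}) \<Longrightarrow> orthogonal z w" "b i = y + z"
      using orthogonal_subspace_decomp_exists[of "b ` {..<i}" "b i"] by blast
    then show "\<exists>q. b i - q \<in> span (b ` {..<i}) \<and> (\<forall>w \<in> span (b ` {..<i}). orthogonal q w)"
      by (intro exI[of _ z]) auto
  qed
  then obtain q where q: "\<And>i. b i - q i \<in> span (b ` {..<i})"
      and orth: "\<And>i w. w \<in> span (b ` {..<i}) \<Longrightarrow> q i \<bullet> w = 0"
    by (auto simp: orthogonal_def)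
  \<comment> \<open>\<open>R\<close> sends \<open>b j\<close> to the axis vector at
    \<open>j\<close>, so coordinate \<open>i\<close> of \<open>R *v v\<close> vanishes on the span
    of the earlier columns but is 1 at \<open>b i\<close>.\<close>
  have "b i \<notin> span (b ` {..<i})" for i
  proof
    assume "b i \<in> span (b ` {..<i})"
    moreover have "span (b ` {..<i}) \<subseteq> {v. (R *v v) $ i = 0}"
      by (rule span_minimal)
         (auto simp: Rb axis_def subspace_def matrix_vector_right_distrib matrix_vector_mult_scaleR)
    ultimately show False by (auto simp: Rb)
  qed
  then have q0: "q i \<noteq> 0" for i
    using q[of i] by auto
  have qq: "q i \<bullet> q j = 0" if "i < j" for i j
  proof -
    have "b i - q i \<in> span (b ` {..<j})"
      using q[of i] that by (meson span_mono image_mono lessThan_subset_iff less_imp_le subsetD)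
    moreover have "b i \<in> span (b ` {..<j})"
      using that by (auto intro: span_base)
    ultimately have "q i \<in> span (b ` {..<j})"
      using span_diff[of "b i" _ "b i - q i"] by simp
    then show ?thesis using orth by (simp add: inner_commute)
  qed
  define U :: "real^('n::{finite,wellorder})^('n::{finite,wellorder})" where "U = (\<chi> i. (1 / norm (q i)) *\<^sub>R q i)"
  have row: "row i U = (1 / norm (q i)) *\<^sub>R q i" for i
    by (simp add: U_def row_def vec_eq_iff)
  have U: "orthogonal_matrix U"
    unfolding orthogonal_matrix_orthonormal_rows
  proof (intro conjI allI impI)
    fix i j :: 'n
    show "norm (row i U) = 1" using q0 by (simp add: row)
    show "orthogonal (row i U) (row j U)" if "i \<noteq> j"
      using qq[of i j] qq[of j i] that
      by (cases i j rule: linorder_cases) (simp_all add: row orthogonal_def inner_commute)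
  qed
  \<comment> \<open>Entry \<open>(i, k)\<close> is the component of \<open>b i\<close> along the
    normalised \<open>q k\<close>, which is 0 when \<open>i\<close> precedes
    \<open>k\<close>.\<close>
  define L where "L = transpose B ** transpose U"
  have L: "L $ i $ k = (1 / norm (q k)) * (q k \<bullet> b i)" for i k
    by (simp add: L_def matrix_matrix_mult_def U_def b_def column_def transpose_def inner_vec_def
        sum_distrib_left algebra_simps)
  have "L $ i $ k = 0" if "i < k" for i k
    using that orth[of "b i" k] by (auto simp: L intro: span_base)
  moreover have "L $ i $ i > 0" for i
  proof -
    have "q i \<bullet> b i = q i \<bullet> q i"
      using orth[OF q[of i]] by (simp add: inner_diff_right)
    then show ?thesis using q0[of i] by (simp add: L)
  qed
  moreover have "L ** transpose L = transpose B ** (transpose U ** U) ** B"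
    by (simp add: L_def matrix_transpose_mul matrix_mul_assoc)
  then have "X = L ** transpose L"
    using U by (simp add: orthogonal_matrix_def X)
  ultimately show ?thesis by (auto simp: pos_lower_triangular_def)
qed

lemma pos_lower_triangular_gram_nth:
  fixes L :: "real^('n::{finite,wellorder})^('n::{finite,wellorder})"
  assumes "pos_lower_triangular L"
  shows "(L ** transpose L) $ i $ j = (\<Sum>k\<in>{..<j}. L $ i $ k * L $ j $ k) + L $ i $ j * L $ j $ j"
proof -
  have "(L ** transpose L) $ i $ j = (\<Sum>k\<in>UNIV. L $ i $ k * L $ j $ k)"
    by (simp add: matrix_matrix_mult_def transpose_def)
  also have "\<dots> = (\<Sum>k\<in>insert j {..<j}. L $ i $ k * L $ j $ k)"
    using assms by (intro sum.mono_neutral_right) (auto simp: pos_lower_triangular_def not_less)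
  finally show ?thesis by simp
qed

text \<open>Strong induction on the column \<open>j\<close>: once the earlier columns agree, the
  Gram entries leave one product each. The diagonal one is a square, fixing the positive
  \<open>L $ j $ j\<close>; division by it fixes the rest of the column.\<close>

lemma cholesky_unique:
  fixes L M :: "real^('n::{finite,wellorder})^('n::{finite,wellorder})"
  assumes L: "pos_lower_triangular L" and M: "pos_lower_triangular M"
    and eq: "L ** transpose L = M ** transpose M"
  shows "L = M"
proof -
  have "\<forall>i. L $ i $ j = M $ i $ j" for j
  proof (induction j rule: less_induct)
    case (less j)
    then have *: "L $ i $ j * L $ j $ j = M $ i $ j * M $ j $ j" for i
      using pos_lower_triangular_gram_nth[OF L, of i j] pos_lower_triangular_gram_nth[OF M, of i j] eq by simp
    have pos: "L $ j $ j > 0" "M $ j $ j > 0"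
      using L M by (auto simp: pos_lower_triangular_def)
    then have "L $ j $ j = M $ j $ j"
      using *[of j] by (metis less_imp_le power2_eq_iff_nonneg power2_eq_square)
    with * pos show ?case by auto
  qed
  then show ?thesis by (simp add: vec_eq_iff)
qed

lemma cholesky_mult_transpose:
  assumes "pos_lower_triangular L"
  shows "cholesky (L ** transpose L) = L"
  unfolding cholesky_def
  using assms cholesky_unique by (intro the_equality) (auto simp: pos_lower_triangular_def)

lemma
  assumes "X \<in> spd"
  shows pos_lower_triangular_cholesky: "pos_lower_triangular (cholesky X)"
    and cholesky_decomposition: "cholesky X ** transpose (cholesky X) = X"
proof -
  obtain L where L: "pos_lower_triangular L" "X = L ** transpose L"
    using cholesky_exists[OF assms] by blast
  then have "cholesky X = L" by (simp add: cholesky_mult_transpose)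
  with L show "pos_lower_triangular (cholesky X)" "cholesky X ** transpose (cholesky X) = X"
    by simp_all
qed

lemma det_pos_lower_triangular:
  assumes "pos_lower_triangular L"
  shows "det L = (\<Prod>i\<in>UNIV. L $ i $ i)"
  using assms by (intro det_lowerdiagonal) (auto simp: pos_lower_triangular_def)

lemma pos_lower_triangular_gram_spd:
  fixes L :: "real^('n::{finite,wellorder})^('n::{finite,wellorder})"
  assumes L: "pos_lower_triangular L"
  shows "L ** transpose L \<in> spd"
proof -
  have "det L > 0"
    using L by (auto simp: pos_lower_triangular_def det_pos_lower_triangular intro: prod_pos)
  then have "det L \<noteq> 0" by simp
  then obtain R where "L ** R = mat 1"
    by (metis invertible_det_nz invertible_right_inverse)
  then have "L ** diag_mat (\<lambda>_. 1) ** transpose L \<in> spd"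
    by (intro congruence_spd diag_mat_spd) auto
  then show ?thesis by simp
qed

lemma log_cholesky_nth:
  "j \<le> i \<Longrightarrow> log_cholesky X $ Abs_lower_index (i, j)
     = (if i = j then ln (cholesky X $ i $ i) else cholesky X $ i $ j)"
  by (simp add: log_cholesky_def Abs_lower_index_inverse)

lemma log_cholesky_inj_on_spd: "inj_on log_cholesky spd"
proof (rule inj_onI)
  fix X Y :: "real^('n::{finite,wellorder})^('n::{finite,wellorder})"
  assume X: "X \<in> spd" and Y: "Y \<in> spd" and eq: "log_cholesky X = log_cholesky Y"
  note LX = pos_lower_triangular_cholesky[OF X, unfolded pos_lower_triangular_def]
    and LY = pos_lower_triangular_cholesky[OF Y, unfolded pos_lower_triangular_def]
  have "cholesky X $ i $ j = cholesky Y $ i $ j" for i j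
  proof (cases i j rule: linorder_cases)
    case less
    with LX LY show ?thesis by simp
  next
    case equal
    with LX LY log_cholesky_nth[of i i X] log_cholesky_nth[of i i Y] eq show ?thesis by simp
  next
    case greater
    then have "j \<le> i" "i \<noteq> j" by auto
    with log_cholesky_nth[of j i X] log_cholesky_nth[of j i Y] eq show ?thesis by simp
  qed
  then have "cholesky X = cholesky Y" by (simp add: vec_eq_iff)
  then show "X = Y" by (metis X Y cholesky_decomposition)
qed

text \<open>Exponentiating the diagonal coordinates turns any vector into a lower triangular matrix
  with positive diagonal. Hence every mean of coordinates is attained.\<close>

lemma log_cholesky_surj: "\<exists>X \<in> spd. log_cholesky X = y"
proof -
  define L where "L = (\<chi> i j. if j < i then y $ Abs_lower_index (i, j)
      else if i = j then exp (y $ Abs_lower_index (i, j)) else 0)"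
  have L: "pos_lower_triangular L"
    by (auto simp: pos_lower_triangular_def L_def)
  have "log_cholesky (L ** transpose L) $ p = y $ p" for p
  proof (cases p)
    case (Abs_lower_index q)
    obtain i j where "q = (i, j)" by fastforce
    with Abs_lower_index L show ?thesis
      by (auto simp: log_cholesky_nth cholesky_mult_transpose) (auto simp: L_def)
  qed
  then have "log_cholesky (L ** transpose L) = y" by (simp add: vec_eq_iff)
  with L show ?thesis using pos_lower_triangular_gram_spd by blast
qed

text \<open>The Log-Cholesky counterpart of the trace; the factor 2 comes from \<open>det X\<close>
  being the square of the determinant of the factor.\<close>

lemma ln_det_eq_sum_log_cholesky:
  assumes "X \<in> spd"
  shows "ln (det X) = 2 * (\<Sum>i\<in>UNIV. log_cholesky X $ Abs_lower_index (i, i))"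
proof -
  let ?L = "cholesky X"
  note L = pos_lower_triangular_cholesky[OF assms]
  have pos: "?L $ i $ i > 0" for i using L by (auto simp: pos_lower_triangular_def)
  then have nz: "?L $ i $ i \<noteq> 0" for i by (metis less_irrefl)
  have "det X = det ?L * det ?L"
    by (subst cholesky_decomposition[OF assms, symmetric]) (simp add: det_mul)
  moreover have "ln (det ?L) = (\<Sum>i\<in>UNIV. ln (?L $ i $ i))" "det ?L > 0"
    using pos nz by (simp_all add: det_pos_lower_triangular[OF L] ln_prod prod_pos)
  ultimately show ?thesis by (simp add: log_cholesky_nth ln_mult)
qed

lemma cholesky_diag_mat:
  assumes "\<And>i. d i > 0"
  shows "cholesky (diag_mat d) = diag_mat (\<lambda>i. sqrt (d i))"
proof -
  have "diag_mat d = diag_mat (\<lambda>i. sqrt (d i)) ** transpose (diag_mat (\<lambda>i. sqrt (d i)))"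
    using assms by (simp add: diag_mat_mult_diag_mat less_imp_le)
  moreover have "pos_lower_triangular (diag_mat (\<lambda>i. sqrt (d i)))"
    using assms by (auto simp: pos_lower_triangular_def diag_mat_nth)
  ultimately show ?thesis using cholesky_mult_transpose by metis
qed

section \<open>Pooling\<close>

text \<open>\<open>inv_into\<close> is meaningful only on the image of \<open>spd\<close>; the
  assumption places the mean of the coordinates there.\<close>

lemma
  assumes "\<exists>Y \<in> spd. \<phi> Y = (1 / real (card I)) *\<^sub>R (\<Sum>h\<in>I. \<phi> (X h))"
  shows mean_via_spd: "mean_via \<phi> I X \<in> spd"
    and coordinates_mean_via: "\<phi> (mean_via \<phi> I X) = (1 / real (card I)) *\<^sub>R (\<Sum>h\<in>I. \<phi> (X h))"
proof -
  have "(1 / real (card I)) *\<^sub>R (\<Sum>h\<in>I. \<phi> (X h)) \<in> \<phi> ` spd"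
    using assms by (metis imageI)
  then show "mean_via \<phi> I X \<in> spd"
    and "\<phi> (mean_via \<phi> I X) = (1 / real (card I)) *\<^sub>R (\<Sum>h\<in>I. \<phi> (X h))"
    unfolding mean_via_def by (rule inv_into_into, rule f_inv_into_f)
qed

lemma mean_via_eqI:
  assumes "inj_on \<phi> spd" and "Y \<in> spd" and "\<phi> Y = (1 / real (card I)) *\<^sub>R (\<Sum>h\<in>I. \<phi> (X h))"
  shows "mean_via \<phi> I X = Y"
  unfolding mean_via_def assms(3)[symmetric] using assms(1,2) by (rule inv_into_f_f)

lemma sym_mats_mean:
  assumes "\<And>h. h \<in> I \<Longrightarrow> S h \<in> sym_mats"
  shows "c *\<^sub>R (\<Sum>h\<in>I. S h) \<in> sym_mats"
  using assms by (simp add: sym_mats_def vec_eq_iff transpose_def)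

lemma
  fixes X :: "'h \<Rightarrow> real^('n::{finite,wellorder})^('n::{finite,wellorder})"
  assumes X: "\<And>h. h \<in> I \<Longrightarrow> X h \<in> spd"
  shows pooling_spd: "pooling g I X \<in> spd"
    and ln_det_pooling: "ln (det (pooling g I X)) = (1 / real (card I)) * (\<Sum>h\<in>I. ln (det (X h)))"
proof -
  \<comment> \<open>A mean of symmetric matrices is symmetric, and its exponential is the required
    positive definite matrix.\<close>
  have ex: "\<exists>Y \<in> spd. mat_log Y = (1 / real (card I)) *\<^sub>R (\<Sum>h\<in>I. mat_log (X h))"
    using sym_mats_mean[of I "\<lambda>h. mat_log (X h)"] X mat_exp_spd mat_log_mat_exp mat_log_sym_mats by metis
  note ex' = log_cholesky_surj[of "(1 / real (card I)) *\<^sub>R (\<Sum>h\<in>I. log_cholesky (X h))"]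
  show spd: "pooling g I X \<in> spd"
    using mean_via_spd[OF ex] mean_via_spd[OF ex'] by (simp add: pooling_def split: geometry.split)
  show "ln (det (pooling g I X)) = (1 / real (card I)) * (\<Sum>h\<in>I. ln (det (X h)))"
  proof (cases g)
    case Log_Euclidean
    have "trace (c *\<^sub>R (\<Sum>h\<in>I. mat_log (X h))) = c * (\<Sum>h\<in>I. trace (mat_log (X h)))" for c
      unfolding trace_def by (subst sum.swap) (simp add: sum_distrib_left)
    then show ?thesis
      using X by (simp only: Log_Euclidean pooling_def geometry.case coordinates_mean_via[OF ex]
          ln_det_eq_trace_mat_log[OF mean_via_spd[OF ex]] ln_det_eq_trace_mat_log cong: sum.cong)
  next
    case Log_Cholesky
    have "ln (det (pooling g I X))
        = 2 * (\<Sum>i\<in>UNIV. (1 / real (card I)) * (\<Sum>h\<in>I. log_cholesky (X h) $ Abs_lower_index (i, i)))"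
      by (simp add: Log_Cholesky pooling_def ln_det_eq_sum_log_cholesky[OF mean_via_spd[OF ex']]
          coordinates_mean_via[OF ex'])
    also have "\<dots> = (1 / real (card I)) * (\<Sum>h\<in>I. 2 * (\<Sum>i\<in>UNIV. log_cholesky (X h) $ Abs_lower_index (i, i)))"
      by (simp add: sum_distrib_left[symmetric] sum_divide_distrib[symmetric]) (rule disjI2, rule sum.swap)
    finally show ?thesis using X by (simp add: ln_det_eq_sum_log_cholesky)
  qed
qed

text \<open>The power clears the factor \<open>1 / card I\<close> and removes the logarithms,
  leaving a right-hand side polynomial in the entries of the \<open>X h\<close>.\<close>

lemma det_pooling_power:
  fixes X :: "'h \<Rightarrow> real^('n::{finite,wellorder})^('n::{finite,wellorder})"
  assumes X: "\<And>h. h \<in> I \<Longrightarrow> X h \<in> spd" and I: "finite I" "I \<noteq> {}"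
  shows "det (pooling g I X) ^ card I = (\<Prod>h\<in>I. det (X h))"
proof -
  have pos: "det (pooling g I X) > 0"
    by (intro det_spd_pos pooling_spd X)
  then have "ln (det (pooling g I X) ^ card I) = (\<Sum>h\<in>I. ln (det (X h)))"
    using I by (simp add: ln_realpow ln_det_pooling[OF X])
  also have "\<dots> = ln (\<Prod>h\<in>I. det (X h))"
    using I det_spd_pos[OF X] by (subst ln_prod) (auto dest: less_imp_neq[symmetric])
  finally show ?thesis
    using det_spd_pos[OF X] pos
    by (subst (asm) ln_inj_iff) (auto intro: prod_pos)
qed

text \<open>The diagonal coordinates are \<open>ln (d h i)\<close> in one geometry and half of that
  in the other, while off-diagonal ones vanish; the common factor does not affect the mean.\<close>

lemma pooling_diag_mat:
  fixes d :: "'h \<Rightarrow> 'n::{finite,wellorder} \<Rightarrow> real"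
  assumes d: "\<And>h i. d h i > 0"
  shows "pooling g I (\<lambda>h. diag_mat (d h)) = diag_mat (\<lambda>i. exp ((1 / real (card I)) * (\<Sum>h\<in>I. ln (d h i))))"
    (is "_ = ?Y")
proof -
  have Y: "?Y \<in> spd" by (rule diag_mat_spd) simp
  have "mat_log ?Y = (1 / real (card I)) *\<^sub>R (\<Sum>h\<in>I. mat_log (diag_mat (d h)))"
    using d by (simp add: mat_log_diag_mat vec_eq_iff diag_mat_nth)
  then have E: "mean_via mat_log I (\<lambda>h. diag_mat (d h)) = ?Y"
    by (rule mean_via_eqI[OF mat_log_inj_on_spd Y])
  have "log_cholesky ?Y $ p = ((1 / real (card I)) *\<^sub>R (\<Sum>h\<in>I. log_cholesky (diag_mat (d h)))) $ p" for p
    using d by (cases "Rep_lower_index p")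
      (simp add: log_cholesky_def cholesky_diag_mat diag_mat_nth ln_sqrt less_imp_le sum_divide_distrib[symmetric])
  then have "log_cholesky ?Y = (1 / real (card I)) *\<^sub>R (\<Sum>h\<in>I. log_cholesky (diag_mat (d h)))"
    unfolding vec_eq_iff by blast
  then have "mean_via log_cholesky I (\<lambda>h. diag_mat (d h)) = ?Y"
    by (rule mean_via_eqI[OF log_cholesky_inj_on_spd Y])
  with E show ?thesis by (simp add: pooling_def split: geometry.split)
qed

section \<open>Pooling of diagonal matrices with one free entry\<close>

definition diag_at :: "'n \<Rightarrow> real \<Rightarrow> real^'n^'n" where
  "diag_at i t = diag_mat (\<lambda>j. if j = i then t else 1)"

lemma diag_at_nth: "diag_at i t $ a $ b = (if a = b then if a = i then t else 1 else 0)"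
  by (simp add: diag_at_def diag_mat_nth)

lemma diag_at_spd: "t > 0 \<Longrightarrow> diag_at i t \<in> spd"
  unfolding diag_at_def by (rule diag_mat_spd) simp

lemma det_diag_at: "det (diag_at i t) = t"
  by (simp add: diag_at_def det_diag_mat prod.delta)

lemma pooling_diag_at:
  fixes i :: "'n::{finite,wellorder}"
  assumes "\<And>h. t h > 0"
  shows "pooling g I (\<lambda>h. diag_at i (t h)) = diag_at i (exp ((1 / real (card I)) * (\<Sum>h\<in>I. ln (t h))))"
proof -
  have "(\<lambda>j. exp ((1 / real (card I)) * (\<Sum>h\<in>I. ln (if j = i then t h else 1))))
      = (\<lambda>j. if j = i then exp ((1 / real (card I)) * (\<Sum>h\<in>I. ln (t h))) else 1)"
    by auto
  then show ?thesis
    unfolding diag_at_def using assms by (subst pooling_diag_mat) auto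
qed

lemma pooling_diag_at_single:
  fixes i :: "'n::{finite,wellorder}"
  assumes "t > 0" and "finite I" and "h0 \<in> I"
  shows "pooling g I (\<lambda>h. diag_at i (if h = h0 then t ^ card I else 1)) = diag_at i t"
proof -
  have "(\<Sum>h\<in>I. ln (if h = h0 then t ^ card I else 1)) = (\<Sum>h\<in>I. if h = h0 then ln (t ^ card I) else 0)"
    by (intro sum.cong) auto
  also have "\<dots> = real (card I) * ln t"
    using assms by (simp add: ln_realpow)
  finally have "(1 / real (card I)) * (\<Sum>h\<in>I. ln (if h = h0 then t ^ card I else 1)) = ln t"
    using assms by auto
  then show ?thesis
    using assms by (subst pooling_diag_at) auto
qed

lemma pooling_diag_at_const:
  fixes i :: "'n::{finite,wellorder}"
  assumes "t > 0" and "finite I" and "I \<noteq> {}"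
  shows "pooling g I (\<lambda>_. diag_at i t) = diag_at i t"
  using assms by (subst pooling_diag_at) auto

text \<open>Along the inputs \<open>X t\<close> the only varying entry is
  \<open>t ^ CARD('h)\<close>, but the pooled entry is \<open>t\<close>. Three points on this line
  already contradict linearity. With a single matrix pooling is the identity on \<open>spd\<close>,
  whence the bound on the number of heads.\<close>

theorem pooling_not_linear:
  assumes N: "CARD('h::finite) \<ge> 2"
  shows "\<not> (\<exists>T :: (real^('k::{finite,wellorder})^('k::{finite,wellorder}))^'h \<Rightarrow> real^('k::{finite,wellorder})^('k::{finite,wellorder}).
      linear T \<and> (\<forall>X. (\<forall>h. X $ h \<in> spd) \<longrightarrow> pooling g UNIV (\<lambda>h. X $ h) = T X))"
proof
  assume "\<exists>T :: (real^('k::{finite,wellorder})^('k::{finite,wellorder}))^'h \<Rightarrow> real^('k::{finite,wellorder})^('k::{finite,wellorder}).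
      linear T \<and> (\<forall>X. (\<forall>h. X $ h \<in> spd) \<longrightarrow> pooling g UNIV (\<lambda>h. X $ h) = T X)"
  then obtain T :: "(real^('k::{finite,wellorder})^('k::{finite,wellorder}))^'h \<Rightarrow> real^('k::{finite,wellorder})^('k::{finite,wellorder})"
    where T: "linear T" and eq: "\<And>X. (\<forall>h. X $ h \<in> spd) \<Longrightarrow> pooling g UNIV (\<lambda>h. X $ h) = T X"
    by blast
  let ?N = "CARD('h)"
  obtain i :: 'k where True by blast
  obtain h0 :: 'h where True by blast
  define X :: "real \<Rightarrow> (real^('k::{finite,wellorder})^('k::{finite,wellorder}))^'h"
    where "X t = (\<chi> h. diag_at i (if h = h0 then t ^ ?N else 1))" for t
  have TX: "T (X t) = diag_at i t" if "t > 0" for t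
  proof -
    have "pooling g UNIV (\<lambda>h. X t $ h) = T (X t)"
      using that by (intro eq) (simp add: X_def diag_at_spd)
    then show ?thesis
      using pooling_diag_at_single[OF that finite, of h0 UNIV g i] by (simp add: X_def)
  qed
  \<comment> \<open>This is \<open>4 ^ ?N - 1 = (2 ^ ?N + 1) * (2 ^ ?N - 1)\<close> in the varying
    entry.\<close>
  have "X 4 - X 1 = (2 ^ ?N + 1) *\<^sub>R (X 2 - X 1)"
  proof -
    have "(4::real) ^ ?N = 2 ^ ?N * 2 ^ ?N"
      by (metis power_mult_distrib mult_2 numeral_Bit0 one_add_one distrib_right mult_1)
    then show ?thesis
      by (simp add: X_def vec_eq_iff diag_at_nth algebra_simps)
  qed
  then have "T (X 4) - T (X 1) = (2 ^ ?N + 1) *\<^sub>R (T (X 2) - T (X 1))"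
    by (simp only: linear_diff[OF T, symmetric] linear_cmul[OF T, symmetric])
  then have "(T (X 4) - T (X 1)) $ i $ i = ((2 ^ ?N + 1) *\<^sub>R (T (X 2) - T (X 1))) $ i $ i"
    by simp
  \<comment> \<open>For the outputs the same relation reads
    \<open>4 - 1 = (2 ^ ?N + 1) * (2 - 1)\<close>.\<close>
  then have "(2::real) ^ ?N = 2 ^ 1"
    by (simp add: TX diag_at_nth)
  then show False
    using N by (subst (asm) power_inject_exp) auto
qed

section \<open>Repeated blocks\<close>

lemma mult_diag_mat_transpose_nth:
  "(W ** diag_mat d ** transpose W) $ a $ b = (\<Sum>c\<in>UNIV. W $ a $ c * d c * W $ b $ c)"
  by (simp add: matrix_matrix_mult_def[of "W ** diag_mat d"] mult_diag_mat_nth transpose_def)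

text \<open>\<open>diag_at i t\<close> is the identity plus a rank-one matrix scaled by
  \<open>t - 1\<close>, and orthonormal rows preserve the identity. The entries are thus affine in
  every real \<open>t\<close>, including the singular case \<open>t = 0\<close>.\<close>

lemma bimap_diag_at_nth:
  assumes "orthonormal_rows W"
  shows "bimap W (diag_at i t) $ a $ b = (if a = b then 1 else 0) + (t - 1) * (W $ a $ i * W $ b $ i)"
proof -
  have "bimap W (diag_at i t) $ a $ b
      = (\<Sum>c\<in>UNIV. W $ a $ c * W $ b $ c + (if c = i then (t - 1) * (W $ a $ i * W $ b $ i) else 0))"
    unfolding bimap_def diag_at_def mult_diag_mat_transpose_nth
    by (intro sum.cong) (auto simp: algebra_simps)
  also have "\<dots> = (W ** transpose W) $ a $ b + (t - 1) * (W $ a $ i * W $ b $ i)"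
    by (simp add: sum.distrib matrix_matrix_mult_def transpose_def)
  finally show ?thesis
    using assms by (simp add: orthonormal_rows_def mat_def)
qed

lemma orthonormal_rows_iff: "orthonormal_rows W \<longleftrightarrow> (\<forall>a b. W $ a \<bullet> W $ b = (if a = b then 1 else 0))"
proof -
  have row: "row a W = W $ a" for a by (simp add: row_def vec_eq_iff)
  show ?thesis
    by (simp add: row orthonormal_rows_def matrix_mult_transpose_dot_row vec_eq_iff mat_def)
qed

section \<open>Weights that select or average coordinates\<close>

definition selection_matrix :: "('k \<Rightarrow> 'n) \<Rightarrow> real^'n^'k" where
  "selection_matrix \<sigma> = (\<chi> a. axis (\<sigma> a) 1)"

lemma selection_matrix_nth: "selection_matrix \<sigma> $ a $ c = (if c = \<sigma> a then 1 else 0)"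
  by (simp add: selection_matrix_def axis_def)

lemma orthonormal_rows_selection_matrix: "inj \<sigma> \<Longrightarrow> orthonormal_rows (selection_matrix \<sigma>)"
  by (auto simp: orthonormal_rows_iff selection_matrix_def inner_axis_axis inj_eq)

lemma bimap_selection_matrix_diag_at:
  assumes "inj \<sigma>"
  shows "bimap (selection_matrix \<sigma>) (diag_at (\<sigma> p) t) = diag_at p t"
proof -
  have "selection_matrix \<sigma> $ a $ \<sigma> p = (if a = p then 1 else 0)" for a
    using assms by (auto simp: selection_matrix_nth inj_eq)
  then show ?thesis
    by (simp add: vec_eq_iff bimap_diag_at_nth[OF orthonormal_rows_selection_matrix[OF assms]] diag_at_nth)
qed

text \<open>The result is the identity, written as \<open>diag_at p 1\<close> for an arbitrary
  \<open>p\<close> so that it can be pooled with the other heads.\<close>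

lemma bimap_selection_matrix_diag_at_outside:
  assumes "inj \<sigma>" and "i \<notin> range \<sigma>"
  shows "bimap (selection_matrix \<sigma>) (diag_at i t) = diag_at p 1"
proof -
  have "selection_matrix \<sigma> $ a $ i = 0" for a
    using assms by (auto simp: selection_matrix_nth)
  then show ?thesis
    by (simp add: vec_eq_iff bimap_diag_at_nth[OF orthonormal_rows_selection_matrix[OF assms(1)]] diag_at_nth)
qed

definition averaging_matrix :: "('k \<Rightarrow> 'm) \<Rightarrow> 'k \<Rightarrow> 'm \<Rightarrow> real^'m^'k" where
  "averaging_matrix \<tau> r q = (\<chi> a. if a = r then (1 / sqrt 2) *\<^sub>R (axis (\<tau> r) 1 + axis q 1) else axis (\<tau> a) 1)"

lemma averaging_matrix_nth:
  "averaging_matrix \<tau> r q $ a $ c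
     = (if a = r then ((if c = \<tau> r then 1 else 0) + (if c = q then 1 else 0)) / sqrt 2
        else if c = \<tau> a then 1 else 0)"
  by (simp add: averaging_matrix_def axis_def)

lemma orthonormal_rows_averaging_matrix:
  assumes "inj \<tau>" and "q \<notin> range \<tau>"
  shows "orthonormal_rows (averaging_matrix \<tau> r q)"
  using assms
  by (auto simp: orthonormal_rows_iff averaging_matrix_def inner_axis_axis inj_eq inner_add_left
      inner_add_right real_div_sqrt)

text \<open>Only row \<open>r\<close> meets the coordinate \<open>\<tau> r\<close>, with squared
  weight 1/2, so its diagonal entry becomes \<open>1 + (s - 1) / 2\<close>.\<close>

lemma bimap_averaging_matrix_diag_at:
  assumes "inj \<tau>" and "q \<notin> range \<tau>"
  shows "bimap (averaging_matrix \<tau> r q) (diag_at (\<tau> r) s) = diag_at r ((1 + s) / 2)"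
proof -
  have "averaging_matrix \<tau> r q $ a $ \<tau> r = (if a = r then 1 / sqrt 2 else 0)" for a
    using assms by (auto simp: averaging_matrix_nth inj_eq)
  then show ?thesis
    by (simp add: vec_eq_iff bimap_diag_at_nth[OF orthonormal_rows_averaging_matrix[OF assms]] diag_at_nth
        add_divide_distrib diff_divide_distrib)
qed

text \<open>The strict drop in dimension supplies the spare coordinate used by each layer of the
  counterexample.\<close>

lemma ex_inj_not_surj:
  "CARD('k::finite) < CARD('m::finite) \<Longrightarrow> \<exists>(f :: 'k \<Rightarrow> 'm) q. inj f \<and> q \<notin> range f"
proof -
  assume less: "CARD('k) < CARD('m)"
  then obtain f :: "'k \<Rightarrow> 'm" where f: "inj f"
    using inj_on_iff_card_le[of "UNIV :: 'k set" "UNIV :: 'm set"] by auto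
  then have "card (range f) \<noteq> CARD('m)"
    using less by (simp add: card_image)
  then have "range f \<noteq> UNIV" by metis
  with f show ?thesis by blast
qed

section \<open>Differentiability of determinants and the contradiction at the origin\<close>

lemma differentiable_prod_real:
  fixes f :: "'i \<Rightarrow> real \<Rightarrow> real"
  assumes "\<And>i. i \<in> I \<Longrightarrow> f i differentiable at x"
  shows "(\<lambda>t. \<Prod>i\<in>I. f i t) differentiable at x"
  using assms by (induction I rule: infinite_finite_induct) auto

lemma differentiable_det:
  fixes M :: "real \<Rightarrow> real^'n^'n"
  assumes "\<And>a b. (\<lambda>t. M t $ a $ b) differentiable at x"
  shows "(\<lambda>t. det (M t)) differentiable at x"
  unfolding det_def
  by (intro differentiable_sum differentiable_mult differentiable_prod_real ballI assms) auto

text \<open>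
  Along the ray \<open>s > 0\<close> the left-hand side has slope zero at the origin and the right-hand side has not.
\<close>
lemma not_eq_power_of_average:
  fixes f :: "real \<Rightarrow> real"
  assumes f: "f differentiable at 0" and m: "m \<ge> 2" and H: "H \<ge> (1::nat)"
    and eq: "\<And>s. s > 0 \<Longrightarrow> f (s ^ m) = ((1 + s) / 2) ^ H"
  shows False
proof -
  obtain D where D: "(f has_real_derivative D) (at 0)"
    using f by (auto simp: real_differentiable_def)
  define u where "u s = ((1 + s) / 2) ^ H - f (s ^ m)" for s
  \<comment> \<open>Writing 0 as \<open>0 ^ m\<close> fits the chain rule; the inner derivative
    vanishes there because \<open>m \<ge> 2\<close>.\<close>
  have "(f has_real_derivative D) (at (0 ^ m))"
    using D m by (simp add: power_0_left)
  from DERIV_chain2[OF this DERIV_pow]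
  have "((\<lambda>s. f (s ^ m)) has_real_derivative 0) (at 0)"
    using m by (simp add: power_0_left)
  moreover have "((\<lambda>s. ((1 + s) / 2) ^ H) has_real_derivative real H * (1 / 2) ^ (H - Suc 0) * (1 / 2)) (at 0)"
    by (rule derivative_eq_intros refl | simp)+
  ultimately have du: "(u has_real_derivative real H * (1 / 2) ^ (H - Suc 0) * (1 / 2)) (at 0)"
    unfolding u_def using DERIV_diff by fastforce
  have u0: "u s = 0" if "s > 0" for s
    using eq[OF that] by (simp add: u_def)
  \<comment> \<open>The equation is known only for \<open>s > 0\<close>; continuity extends
    \<open>u = 0\<close> to the origin, where the positive derivative then forces positive values
    just to the right.\<close>
  have "(u \<longlongrightarrow> u 0) (at_right 0)"
    using DERIV_isCont[OF du] by (simp add: isCont_def filterlim_at_split)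
  moreover have "(u \<longlongrightarrow> 0) (at_right 0)"
    by (rule tendsto_eventually) (auto simp: eventually_at_right_less u0 eventually_at_filter)
  ultimately have "u 0 = 0"
    using tendsto_unique trivial_limit_at_right_real by blast
  moreover obtain e where "e > 0" "\<And>h. 0 < h \<Longrightarrow> h < e \<Longrightarrow> u 0 < u (0 + h)"
    using DERIV_pos_inc_right[OF du] H by auto
  then have "u 0 < u (0 + e / 2)" by simp
  ultimately show False using u0[of "e / 2"] \<open>e > 0\<close> by simp
qed

text \<open>Two heads in the first layer are essential: with one head its pooling is the identity on
  \<open>spd\<close>, and the block collapses to the weights \<open>W2 h ** W1 0\<close>.\<close>

theorem iterated_bimap_pooling_not_collapsing:
  fixes g :: geometry
  assumes km: "CARD('k::{finite,wellorder}) < CARD('m::{finite,wellorder})"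
    and mn: "CARD('m) < CARD('n::finite)" and H1: "H1 \<ge> 2" and H2: "H2 \<ge> 1"
  shows "\<exists>(W1 :: nat \<Rightarrow> real^'n^('m::{finite,wellorder})) (W2 :: nat \<Rightarrow> real^('m::{finite,wellorder})^('k::{finite,wellorder})).
      (\<forall>h < H1. orthonormal_rows (W1 h)) \<and> (\<forall>h < H2. orthonormal_rows (W2 h)) \<and>
      \<not> (\<exists>H \<ge> 1. \<exists>V :: nat \<Rightarrow> real^'n^('k::{finite,wellorder}).
            (\<forall>h < H. orthonormal_rows (V h)) \<and>
            (\<forall>X \<in> spd. bimap_pooling g H2 W2 (bimap_pooling g H1 W1 X)
                      = bimap_pooling g H V X))"
proof -
  obtain \<tau> :: "'k \<Rightarrow> 'm" and q where \<tau>: "inj \<tau>" "q \<notin> range \<tau>"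
    using ex_inj_not_surj[OF km] by blast
  obtain \<sigma> :: "'m \<Rightarrow> 'n" and z where \<sigma>: "inj \<sigma>" "z \<notin> range \<sigma>"
    using ex_inj_not_surj[OF mn] by blast
  obtain r :: 'k where True by blast
  define p where "p = \<tau> r"
  \<comment> \<open>Redirecting \<open>p\<close> to the spare coordinate \<open>z\<close> hides
    \<open>\<sigma> p\<close> from every head but head 0.\<close>
  define \<sigma>' where "\<sigma>' = \<sigma>(p := z)"
  have \<sigma>': "inj \<sigma>'" "\<sigma> p \<notin> range \<sigma>'"
    using \<sigma> by (auto simp: \<sigma>'_def inj_def)
  define W1 where "W1 h = selection_matrix (if h = 0 then \<sigma> else \<sigma>')" for h :: nat
  define W2 where "W2 h = averaging_matrix \<tau> r q" for h :: nat
  have F1: "bimap_pooling g H1 W1 (diag_at (\<sigma> p) (s ^ H1)) = diag_at p s" if "s > 0" for s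
  proof -
    have "bimap (W1 h) (diag_at (\<sigma> p) (s ^ H1)) = diag_at p (if h = 0 then s ^ card {..<H1} else 1)" for h
      using \<sigma> \<sigma>' by (simp add: W1_def bimap_selection_matrix_diag_at bimap_selection_matrix_diag_at_outside)
    then show ?thesis
      using pooling_diag_at_single[OF that, of "{..<H1}" 0 g p] H1 by (simp add: bimap_pooling_def)
  qed
  \<comment> \<open>All heads of the second layer are equal, so its pooling returns their common
    value.\<close>
  have F2: "bimap_pooling g H2 W2 (diag_at p s) = diag_at r ((1 + s) / 2)" if "s > 0" for s
    using pooling_diag_at_const[of "(1 + s) / 2" "{..<H2}" g r] that H2
    by (simp add: bimap_pooling_def W2_def p_def bimap_averaging_matrix_diag_at[OF \<tau>] lessThan_empty_iff)
  have False
    if H: "H \<ge> 1" and V: "\<forall>h < H. orthonormal_rows (V h)"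
      and collapse: "\<forall>X \<in> spd. bimap_pooling g H2 W2 (bimap_pooling g H1 W1 X) = bimap_pooling g H V X"
    for H and V :: "nat \<Rightarrow> real^'n^('k::{finite,wellorder})"
  proof -
    \<comment> \<open>This is defined for all real \<open>t\<close>, although blocks are compared
      only at positive \<open>t\<close>; that allows differentiation at 0.\<close>
    define f where "f t = (\<Prod>h<H. det (bimap (V h) (diag_at (\<sigma> p) t)))" for t
    have "f (s ^ H1) = ((1 + s) / 2) ^ H" if s: "s > 0" for s
    proof -
      let ?X = "diag_at (\<sigma> p) (s ^ H1)"
      have X: "?X \<in> spd" using s by (simp add: diag_at_spd)
      with collapse F1[OF s] F2[OF s] have "bimap_pooling g H V ?X = diag_at r ((1 + s) / 2)" by metis
      then have "((1 + s) / 2) ^ H = det (pooling g {..<H} (\<lambda>h. bimap (V h) ?X)) ^ card {..<H}"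
        by (simp add: bimap_pooling_def det_diag_at)
      also have "\<dots> = f (s ^ H1)"
        unfolding f_def using H V X by (intro det_pooling_power) (auto intro: bimap_spd simp: lessThan_empty_iff)
      finally show ?thesis ..
    qed
    moreover have "f differentiable at 0"
      unfolding f_def using V
      by (intro differentiable_prod_real differentiable_det) (simp add: bimap_diag_at_nth)
    ultimately show False
      using not_eq_power_of_average H1 H by blast
  qed
  moreover have "orthonormal_rows (W1 h)" "orthonormal_rows (W2 h)" for h
    using \<sigma> \<sigma>' \<tau>
    by (simp_all add: W1_def W2_def orthonormal_rows_selection_matrix orthonormal_rows_averaging_matrix)
  ultimately show ?thesis
    by (intro exI[of _ W1] exI[of _ W2] conjI notI) auto
qed

theorem proposition4:
  fixes g :: geometry
  shows
    "(CARD('h::finite) \<ge> 2 \<longrightarrow>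
        \<not> (\<exists>T :: (real^('k::{finite,wellorder})^('k::{finite,wellorder}))^'h \<Rightarrow> real^('k::{finite,wellorder})^('k::{finite,wellorder}).
              linear T \<and> (\<forall>X. (\<forall>h. X $ h \<in> spd) \<longrightarrow> pooling g UNIV (\<lambda>h. X $ h) = T X)))
     \<and>
     (CARD('k::{finite,wellorder}) < CARD('m::{finite,wellorder}) \<and> CARD('m) < CARD('n::finite) \<longrightarrow>
        (\<forall>H1 \<ge> 2. \<forall>H2 \<ge> 1.
          \<exists>(W1 :: nat \<Rightarrow> real^'n^('m::{finite,wellorder})) (W2 :: nat \<Rightarrow> real^('m::{finite,wellorder})^('k::{finite,wellorder})).
            (\<forall>h < H1. orthonormal_rows (W1 h)) \<and> (\<forall>h < H2. orthonormal_rows (W2 h)) \<and>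
            \<not> (\<exists>H \<ge> 1. \<exists>V :: nat \<Rightarrow> real^'n^('k::{finite,wellorder}).
                  (\<forall>h < H. orthonormal_rows (V h)) \<and>
                  (\<forall>X \<in> spd. bimap_pooling g H2 W2 (bimap_pooling g H1 W1 X)
                            = bimap_pooling g H V X))))"
proof (intro conjI impI allI, goal_cases)
  case 1
  then show ?case by (rule pooling_not_linear)
next
  case (2 H1 H2)
  then show ?case by (elim conjE) (rule iterated_bimap_pooling_not_collapsing)
qed

end
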